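(* Suppose that the Regularity assumption, the Parameter assumption and the Localization assumption of the context hold, and run NR-LALM (with exact gradients) from $(x_0,\lambda_0)$. For $K\ge2$, let $\widehat k$ be uniformly distributed over $\{1,\ldots,K-1\}$. Then $$\min_{1\le k\le K-1}\mathcal R_{k+1}^2\le\mathbb E[\mathcal R_{\widehat k+1}^2]\le\frac{C_{\mathrm{det}}}{K-1},\qquad C_{\mathrm{det}}:=C_R\left[\Delta^2+\frac{8(\Phi_1-\underline\Phi)}{\beta}\right],$$ where $C_{\mathrm{det}}$ is independent of $K$ and $\varepsilon$. In particular, for $\varepsilon>0$, if $K-1\ge C_{\mathrm{det}}\varepsilon^{-2}$ and $k_\star$ minimizes $\mathcal R_{k+1}$ over $1\le k\le K-1$, then $(x_{k_\star+1},\lambda_{k_\star+1})$ is an $\varepsilon$-KKT pair. Thus an $\varepsilon$-KKT pair is obtained using $\mathcal O(\varepsilon^{-2})$ iterations, $\mathcal O(\varepsilon^{-2})$ first-order oracle evaluations, and $\mathcal O(\varepsilon^{-2})$ exact linear-system solves (with matrices $\beta I_n+\rho\nabla c(x_k)\nabla c(x_k)^\top$), with a fixed penalty parameter $\rho$ and the multiplier update $\lambda_{k+1}=\lambda_k+\rho c(x_{k+1})$.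
   Context: Problem: minimize $f(x)$ over $x\in\mathbb R^n$ subject to $c(x)=0$, with $f:\mathbb R^n\to\mathbb R$, $c:\mathbb R^n\to\mathbb R^m$. Norms are Euclidean for vectors and spectral for matrices; $\nabla c(x):=(\nabla c_1(x),\ldots,\nabla c_m(x))\in\mathbb R^{n\times m}$. The augmented Lagrangian is $\mathcal L_\rho(x,\lambda):=f(x)+\langle\lambda,c(x)\rangle+\frac{\rho}{2}\|c(x)\|^2$. A pair $(x,\lambda)$ is an $\varepsilon$-KKT pair if $\|\nabla f(x)+\nabla c(x)\lambda\|\le\varepsilon$ and $\|c(x)\|\le\varepsilon$. The KKT residual is $\mathcal R(x,\lambda):=(\|\nabla f(x)+\nabla c(x)\lambda\|^2+\|c(x)\|^2)^{1/2}$, and $\mathcal R_k:=\mathcal R(x_k,\lambda_k)$. Regularity assumption: $f$ and $c$ are continuously differentiable on a nonempty open set $\mathcal U\subseteq\mathbb R^n$, and there are $\underline f\in\mathbb R$ and positive constants $G,L_f,M,L_c,\sigma$ such that for all $x,y\in\mathcal U$ and $u\in\mathbb R^m$: (i) $f(x)\ge\underline f$, $\|\nabla f(x)\|\le G$, $\|\nabla f(x)-\nabla f(y)\|\le L_f\|x-y\|$; (ii) $\|\nabla c(x)\|\le M$, $\|\nabla c(x)-\nabla c(y)\|\le L_c\|x-y\|$; (iii) $\|\nabla c(x)u\|\ge\sigma\|u\|$. Constants: $\kappa_{\mathrm{lin}}:=L_c/2$ and, for $\beta,\rho,\Delta,\Lambda>0$, $$C_{\mathrm{mod}}:=\frac{L_f}{2}+\kappa_{\mathrm{lin}}(3\Lambda+\rho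 M\Delta)+\frac{\rho}{2}\kappa_{\mathrm{lin}}^2\Delta^2,\quad A_p:=\beta+\rho M\kappa_{\mathrm{lin}}\Delta,\quad B_p:=A_p+L_f+L_c\Lambda,\quad C_{\lambda,p}:=\frac{4}{\sigma^2}\max\{A_p^2,B_p^2\},$$ $C_s:=\beta+\rho M\kappa_{\mathrm{lin}}\Delta+L_f+L_c\Lambda$, $C_R:=C_s^2+C_{\lambda,p}/\rho^2$. Parameter assumption: the fixed constants $\beta,\rho,\Delta,\Lambda>0$, independent of the target accuracy $\varepsilon$, satisfy $$\Lambda\ge\frac{G+\beta\Delta+\rho M\kappa_{\mathrm{lin}}\Delta^2}{\sigma},\quad \frac{G}{\beta}+\frac{3M\Lambda}{\beta+\rho\sigma^2}\le\Delta,\quad C_{\mathrm{mod}}\le\frac{3\beta}{8},\quad \rho\ge\frac{8C_{\lambda,p}}{\beta},$$ and the initial pair satisfies $\|\lambda_0\|\le\Lambda$ and $\rho\|c(x_0)\|\le\Lambda$. NR-LALM (deterministic): from $(x_0,\lambda_0)\in\mathbb R^n\times\mathbb R^m$, for $k=0,1,2,\ldots$, $p_k$ is the solution of $$(\beta I_n+\rho\nabla c(x_k)\nabla c(x_k)^\top)p_k=-\nabla f(x_k)-\nabla c(x_k)(\lambda_k+\rho c(x_k)),$$ and $x_{k+1}=x_k+p_k$, $\lambda_{k+1}=\lambda_k+\rho c(x_{k+1})$. Cost accounting: after the initial evaluation of $c(x_0)$, each iteration evaluates $\nabla f(x_k)$, $\nabla c(x_k)$ and $c(x_{k+1})$ once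 each (first-order oracle evaluations) and solves one linear system. Localization: let $$\overline\Phi_1:=f(x_0)+G\Delta+\frac{4\Lambda^2}{\rho}+\frac{C_{\lambda,p}}{\rho}\Delta^2,\quad H_{\mathrm{det}}:=\overline\Phi_1+\frac{\Lambda^2}{2\rho},\quad \mathcal S_{\mathrm{det}}:=\{x\in\mathbb R^n:f(x)\le H_{\mathrm{det}},\ \|c(x)\|\le2\Lambda/\rho\},$$ and $\mathcal N_r(S):=\{y\in\mathbb R^n:\operatorname{dist}(y,S)\le r\}$. Localization assumption: $\mathcal N_\Delta(\mathcal S_{\mathrm{det}})\subset\mathcal U$. For $k\ge1$, $\Phi_k:=\mathcal L_\rho(x_k,\lambda_k)+\frac{C_{\lambda,p}}{\rho}\|p_{k-1}\|^2$, and $\underline\Phi:=\underline f-\Lambda^2/(2\rho)$. *)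

theory Defs
  imports "HOL-Probability.Probability" "HOL-Library.Landau_Symbols"
begin

definition grad :: "('a::real_inner \<Rightarrow> real) \<Rightarrow> 'a \<Rightarrow> 'a" where
  "grad f x = (THE D. GDERIV f x :> D)"

text \<open>The \<open>n \<times> m\<close> matrix whose columns are the gradients of the components of \<open>c\<close>
  (the transpose of the Jacobian matrix).\<close>

definition grad_vec :: "(real^'n \<Rightarrow> real^'m) \<Rightarrow> real^'n \<Rightarrow> real^'m^'n" where
  "grad_vec c x = (\<chi> i j. grad (\<lambda>y. c y $ j) x $ i)"

text \<open>The library's \<open>norm\<close> on matrices is the Frobenius norm, not the spectral norm.\<close>

definition spectral_norm :: "real^'m^'n \<Rightarrow> real" where
  "spectral_norm A = onorm (\<lambda>v. A *v v)"

definition aug_lagrangian ::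
    "(real^'n \<Rightarrow> real) \<Rightarrow> (real^'n \<Rightarrow> real^'m) \<Rightarrow> real \<Rightarrow> real^'n \<Rightarrow> real^'m \<Rightarrow> real" where
  "aug_lagrangian f c r x l = f x + l \<bullet> c x + r / 2 * (norm (c x))\<^sup>2"

definition eps_KKT ::
    "(real^'n \<Rightarrow> real) \<Rightarrow> (real^'n \<Rightarrow> real^'m) \<Rightarrow> real \<Rightarrow> real^'n \<Rightarrow> real^'m \<Rightarrow> bool" where
  "eps_KKT f c \<epsilon> x l \<longleftrightarrow> norm (grad f x + grad_vec c x *v l) \<le> \<epsilon> \<and> norm (c x) \<le> \<epsilon>"

definition KKT_residual ::
    "(real^'n \<Rightarrow> real) \<Rightarrow> (real^'n \<Rightarrow> real^'m) \<Rightarrow> real^'n \<Rightarrow> real^'m \<Rightarrow> real" where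
  "KKT_residual f c x l = sqrt ((norm (grad f x + grad_vec c x *v l))\<^sup>2 + (norm (c x))\<^sup>2)"

record reg_consts =
  f_low :: real
  G_f :: real
  L_f :: real
  M_c :: real
  L_c :: real
  sig_c :: real

record alg_params =
  beta :: real
  rho :: real
  Del :: real
  Lam :: real

definition regularity ::
    "(real^'n \<Rightarrow> real) \<Rightarrow> (real^'n \<Rightarrow> real^'m) \<Rightarrow> (real^'n) set \<Rightarrow> reg_consts \<Rightarrow> bool" where
  "regularity f c U r \<longleftrightarrow>
     open U \<and> U \<noteq> {} \<and>
     (\<forall>x\<in>U. f differentiable (at x)) \<and> continuous_on U (grad f) \<and>
     (\<forall>x\<in>U. c differentiable (at x)) \<and> continuous_on U (grad_vec c) \<and>
     0 < G_f r \<and> 0 < L_f r \<and> 0 < M_c r \<and> 0 < L_c r \<and> 0 < sig_c r \<and>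
     (\<forall>x\<in>U. f_low r \<le> f x \<and> norm (grad f x) \<le> G_f r) \<and>
     (\<forall>x\<in>U. \<forall>y\<in>U. norm (grad f x - grad f y) \<le> L_f r * norm (x - y)) \<and>
     (\<forall>x\<in>U. spectral_norm (grad_vec c x) \<le> M_c r) \<and>
     (\<forall>x\<in>U. \<forall>y\<in>U. spectral_norm (grad_vec c x - grad_vec c y) \<le> L_c r * norm (x - y)) \<and>
     (\<forall>x\<in>U. \<forall>u. sig_c r * norm u \<le> norm (grad_vec c x *v u))"

definition kappa_lin :: "reg_consts \<Rightarrow> real" where
  "kappa_lin r = L_c r / 2"

definition C_mod :: "reg_consts \<Rightarrow> alg_params \<Rightarrow> real" where
  "C_mod r q = L_f r / 2 + kappa_lin r * (3 * Lam q + rho q * M_c r * Del q)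
     + rho q / 2 * (kappa_lin r)\<^sup>2 * (Del q)\<^sup>2"

definition A_p :: "reg_consts \<Rightarrow> alg_params \<Rightarrow> real" where
  "A_p r q = beta q + rho q * M_c r * kappa_lin r * Del q"

definition B_p :: "reg_consts \<Rightarrow> alg_params \<Rightarrow> real" where
  "B_p r q = A_p r q + L_f r + L_c r * Lam q"

definition C_lam_p :: "reg_consts \<Rightarrow> alg_params \<Rightarrow> real" where
  "C_lam_p r q = 4 / (sig_c r)\<^sup>2 * max ((A_p r q)\<^sup>2) ((B_p r q)\<^sup>2)"

definition C_s :: "reg_consts \<Rightarrow> alg_params \<Rightarrow> real" where
  "C_s r q = beta q + rho q * M_c r * kappa_lin r * Del q + L_f r + L_c r * Lam q"

definition C_R :: "reg_consts \<Rightarrow> alg_params \<Rightarrow> real" where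
  "C_R r q = (C_s r q)\<^sup>2 + C_lam_p r q / (rho q)\<^sup>2"

definition parameter_cond ::
    "(real^'n \<Rightarrow> real^'m) \<Rightarrow> reg_consts \<Rightarrow> alg_params \<Rightarrow> real^'n \<Rightarrow> real^'m \<Rightarrow> bool" where
  "parameter_cond c r q x0 l0 \<longleftrightarrow>
     0 < beta q \<and> 0 < rho q \<and> 0 < Del q \<and> 0 < Lam q \<and>
     Lam q \<ge> (G_f r + beta q * Del q + rho q * M_c r * kappa_lin r * (Del q)\<^sup>2) / sig_c r \<and>
     G_f r / beta q + 3 * M_c r * Lam q / (beta q + rho q * (sig_c r)\<^sup>2) \<le> Del q \<and>
     C_mod r q \<le> 3 * beta q / 8 \<and>
     rho q \<ge> 8 * C_lam_p r q / beta q \<and>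
     norm l0 \<le> Lam q \<and> rho q * norm (c x0) \<le> Lam q"

definition Phi1_bar :: "(real^'n \<Rightarrow> real) \<Rightarrow> reg_consts \<Rightarrow> alg_params \<Rightarrow> real^'n \<Rightarrow> real" where
  "Phi1_bar f r q x0 =
     f x0 + G_f r * Del q + 4 * (Lam q)\<^sup>2 / rho q + C_lam_p r q / rho q * (Del q)\<^sup>2"

definition H_det :: "(real^'n \<Rightarrow> real) \<Rightarrow> reg_consts \<Rightarrow> alg_params \<Rightarrow> real^'n \<Rightarrow> real" where
  "H_det f r q x0 = Phi1_bar f r q x0 + (Lam q)\<^sup>2 / (2 * rho q)"

definition S_det ::
    "(real^'n \<Rightarrow> real) \<Rightarrow> (real^'n \<Rightarrow> real^'m) \<Rightarrow> reg_consts \<Rightarrow> alg_params \<Rightarrow> real^'n \<Rightarrow> (real^'n) set"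
  where "S_det f c r q x0 = {x. f x \<le> H_det f r q x0 \<and> norm (c x) \<le> 2 * Lam q / rho q}"

text \<open>The guard reflects the convention \<open>dist(y, {}) = \<infinity>\<close>, whereas \<open>infdist y {} = 0\<close>.\<close>

definition closed_nbhd :: "real \<Rightarrow> 'a::metric_space set \<Rightarrow> 'a set" where
  "closed_nbhd d S = {y. S \<noteq> {} \<and> infdist y S \<le> d}"

definition system_matrix ::
    "(real^'n \<Rightarrow> real^'m) \<Rightarrow> alg_params \<Rightarrow> real^'n \<Rightarrow> real^'n^'n" where
  "system_matrix c q x =
     beta q *\<^sub>R mat 1 + rho q *\<^sub>R (grad_vec c x ** transpose (grad_vec c x))"

definition system_rhs ::
    "(real^'n \<Rightarrow> real) \<Rightarrow> (real^'n \<Rightarrow> real^'m) \<Rightarrow> alg_params \<Rightarrow> real^'n \<Rightarrow> real^'m \<Rightarrow> real^'n" where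
  "system_rhs f c q x l = - grad f x - grad_vec c x *v (l + rho q *\<^sub>R c x)"

definition NR_LALM ::
    "(real^'n \<Rightarrow> real) \<Rightarrow> (real^'n \<Rightarrow> real^'m) \<Rightarrow> alg_params \<Rightarrow> real^'n \<Rightarrow> real^'m \<Rightarrow>
     (nat \<Rightarrow> real^'n) \<Rightarrow> (nat \<Rightarrow> real^'m) \<Rightarrow> (nat \<Rightarrow> real^'n) \<Rightarrow> bool" where
  "NR_LALM f c q x0 l0 x l p \<longleftrightarrow>
     x 0 = x0 \<and> l 0 = l0 \<and>
     (\<forall>k. system_matrix c q (x k) *v p k = system_rhs f c q (x k) (l k) \<and>
          x (Suc k) = x k + p k \<and>
          l (Suc k) = l k + rho q *\<^sub>R c (x (Suc k)))"

text \<open>The linear system of each iteration has exactly one solution, so a run is uniquely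
  determined by the initial pair.\<close>

lemma system_matrix_ex1:
  assumes "0 < beta q" "0 < rho q"
  shows "\<exists>!p. system_matrix c q x *v p = b"
proof -
  let ?A = "system_matrix c q x" and ?B = "grad_vec c x"
  have mv: "?A *v v = beta q *\<^sub>R v + rho q *\<^sub>R (?B *v (transpose ?B *v v))" for v
    by (simp add: system_matrix_def matrix_vector_mult_add_rdistrib
        scaleR_matrix_vector_assoc[symmetric] matrix_vector_mul_assoc[symmetric])
  have quad: "v \<bullet> (?A *v v) = beta q * (v \<bullet> v) + rho q * ((transpose ?B *v v) \<bullet> (transpose ?B *v v))" for v
    by (simp add: mv inner_right_distrib dot_lmul_matrix[symmetric])
  have "v = 0" if "?A *v v = 0" for v
  proof -
    have "beta q * (v \<bullet> v) + rho q * ((transpose ?B *v v) \<bullet> (transpose ?B *v v)) = 0"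
      using quad[of v] that by simp
    moreover have "0 \<le> rho q * ((transpose ?B *v v) \<bullet> (transpose ?B *v v))"
      using assms by simp
    moreover have "0 \<le> beta q * (v \<bullet> v)" using assms by simp
    ultimately have "beta q * (v \<bullet> v) = 0" by linarith
    then show ?thesis using assms by simp
  qed
  then have "invertible ?A"
    using matrix_left_invertible_ker invertible_left_inverse by blast
  then show ?thesis
    by (metis invertible_def matrix_vector_mul_assoc matrix_vector_mul_lid)
qed

lemma NR_LALM_exists:
  assumes "0 < beta q" "0 < rho q"
  shows "\<exists>x l p. NR_LALM f c q x0 l0 x l p"
proof -
  define P where "P = (\<lambda>y m. THE p. system_matrix c q y *v p = system_rhs f c q y m)"
  have P: "system_matrix c q y *v P y m = system_rhs f c q y m" for y m
    unfolding P_def by (rule theI') (rule system_matrix_ex1[OF assms])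
  define s where "s = rec_nat (x0, l0) (\<lambda>_ z. let y = fst z + P (fst z) (snd z)
                                          in (y, snd z + rho q *\<^sub>R c y))"
  have "NR_LALM f c q x0 l0 (\<lambda>k. fst (s k)) (\<lambda>k. snd (s k)) (\<lambda>k. P (fst (s k)) (snd (s k)))"
    unfolding NR_LALM_def by (simp add: P s_def Let_def)
  then show ?thesis by blast
qed

datatype (discs_sels) ('x, 'a) algo_call = Eval_grad_f 'x | Eval_grad_c 'x | Eval_c 'x | Lin_solve 'a 'x

text \<open>The calls made during the first \<open>k\<close> iterations. The value \<open>c (x k)\<close> used in iteration \<open>k\<close> is the one already evaluated in the
  preceding iteration (or initially).\<close>

primrec calls ::
    "(real^'n \<Rightarrow> real) \<Rightarrow> (real^'n \<Rightarrow> real^'m) \<Rightarrow> alg_params \<Rightarrow>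
     (nat \<Rightarrow> real^'n) \<Rightarrow> (nat \<Rightarrow> real^'m) \<Rightarrow> nat \<Rightarrow> (real^'n, real^'n^'n) algo_call list" where
  "calls f c q x l 0 = [Eval_c (x 0)]"
| "calls f c q x l (Suc k) = calls f c q x l k @
     [Eval_grad_f (x k), Eval_grad_c (x k),
      Lin_solve (system_matrix c q (x k)) (system_rhs f c q (x k) (l k)),
      Eval_c (x (Suc k))]"

definition num_lin_solves :: "('x, 'a) algo_call list \<Rightarrow> nat" where
  "num_lin_solves cs = length (filter is_Lin_solve cs)"

definition num_oracle_evals :: "('x, 'a) algo_call list \<Rightarrow> nat" where
  "num_oracle_evals cs = length (filter (\<lambda>a. \<not> is_Lin_solve a) cs)"

text \<open>Only meant for \<open>k \<ge> 1\<close>.\<close>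

definition Phi ::
    "(real^'n \<Rightarrow> real) \<Rightarrow> (real^'n \<Rightarrow> real^'m) \<Rightarrow> reg_consts \<Rightarrow> alg_params \<Rightarrow>
     (nat \<Rightarrow> real^'n) \<Rightarrow> (nat \<Rightarrow> real^'m) \<Rightarrow> (nat \<Rightarrow> real^'n) \<Rightarrow> nat \<Rightarrow> real" where
  "Phi f c r q x l p k =
     aug_lagrangian f c (rho q) (x k) (l k) + C_lam_p r q / rho q * (norm (p (k - 1)))\<^sup>2"

definition Phi_low :: "reg_consts \<Rightarrow> alg_params \<Rightarrow> real" where
  "Phi_low r q = f_low r - (Lam q)\<^sup>2 / (2 * rho q)"

definition C_det ::
    "(real^'n \<Rightarrow> real) \<Rightarrow> (real^'n \<Rightarrow> real^'m) \<Rightarrow> reg_consts \<Rightarrow> alg_params \<Rightarrow>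
     (nat \<Rightarrow> real^'n) \<Rightarrow> (nat \<Rightarrow> real^'m) \<Rightarrow> (nat \<Rightarrow> real^'n) \<Rightarrow> real" where
  "C_det f c r q x l p =
     C_R r q * ((Del q)\<^sup>2 + 8 * (Phi f c r q x l p 1 - Phi_low r q) / beta q)"

definition iteration_budget :: "real \<Rightarrow> real \<Rightarrow> nat" where
  "iteration_budget C \<epsilon> = (LEAST K. 2 \<le> K \<and> C / \<epsilon>\<^sup>2 \<le> real K - 1)"

end

theory Submission
  imports Defs
begin

text \<open>Since the multiplier step uses the constraint value at the new point, the linear system says that
  \<open>\<nabla>f(x\<^sub>k) + \<nabla>c(x\<^sub>k) \<lambda>\<^sub>k\<^sub>+\<^sub>1\<close> equals
  \<open>- \<beta> p\<^sub>k\<close> up to the linearization error of \<open>c\<close>, which is quadratic in \<open>p\<^sub>k\<close>.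
  With the lower singular value bound this keeps the multipliers bounded, and the differences
  of two consecutive such relations bound \<open>\<lambda>\<^sub>k\<^sub>+\<^sub>1 - \<lambda>\<^sub>k\<close> by the last two steps.
  The step decreases the augmented Lagrangian by \<open>5\<beta>/8 \<parallel>p\<^sub>k\<parallel>\<^sup>2\<close>, which pays for
  the increase caused by the multiplier update once the previous step is stored in the Lyapunov
  function \<open>\<Phi>\<close>. Monotonicity of \<open>\<Phi>\<close> in turn keeps the iterates in the
  localization set, so all estimates propagate by induction; telescoping \<open>\<Phi>\<close> bounds the
  sum of the squared steps and hence of the squared residuals.\<close>

section \<open>Gradients, Jacobians and Taylor estimates\<close>

text \<open>The coordinates of the derivative on \<open>Basis\<close> give a gradient vector, and
  uniqueness of derivatives makes the description in \<open>grad\<close> denote it.\<close>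

lemma has_derivative_grad:
  fixes f :: "'a::euclidean_space \<Rightarrow> real"
  assumes "f differentiable (at x)"
  shows "(f has_derivative (\<lambda>h. grad f x \<bullet> h)) (at x)"
proof -
  obtain f' where f': "(f has_derivative f') (at x)"
    using assms by (auto simp: differentiable_def)
  interpret bounded_linear f' using f' by (rule has_derivative_bounded_linear)
  have "f' h = h \<bullet> (\<Sum>b\<in>Basis. f' b *\<^sub>R b)" for h
  proof -
    have "f' h = f' (\<Sum>b\<in>Basis. (h \<bullet> b) *\<^sub>R b)" by (simp add: euclidean_representation)
    also have "\<dots> = (\<Sum>b\<in>Basis. (h \<bullet> b) * f' b)" by (simp add: sum scaleR)
    finally show ?thesis by (simp add: inner_sum_right mult.commute)
  qed
  then have "f' = (\<lambda>h. h \<bullet> (\<Sum>b\<in>Basis. f' b *\<^sub>R b))" by (rule ext)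
  with f' have D: "GDERIV f x :> (\<Sum>b\<in>Basis. f' b *\<^sub>R b)"
    unfolding gderiv_def by simp
  have unique: "D' = (\<Sum>b\<in>Basis. f' b *\<^sub>R b)" if "GDERIV f x :> D'" for D'
    using has_derivative_unique[OF that[unfolded gderiv_def] D[unfolded gderiv_def]]
    by (metis vector_eq_ldot)
  have "grad f x = (\<Sum>b\<in>Basis. f' b *\<^sub>R b)"
    unfolding grad_def by (rule the_equality, rule D, erule unique)
  with D have "GDERIV f x :> grad f x" by (simp only:)
  then show ?thesis by (simp add: gderiv_def inner_commute)
qed

lemma has_derivative_grad_vec:
  fixes c :: "real^'n \<Rightarrow> real^'m"
  assumes "c differentiable (at x)"
  shows "(c has_derivative (\<lambda>h. transpose (grad_vec c x) *v h)) (at x)"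
proof -
  have "((\<lambda>y. c y $ j) has_derivative (\<lambda>h. (transpose (grad_vec c x) *v h) $ j)) (at x)" for j
  proof -
    have "(\<lambda>y. c y $ j) differentiable (at x)"
      using assms bounded_linear.has_derivative[OF bounded_linear_vec_nth]
      unfolding differentiable_def by blast
    moreover have "(transpose (grad_vec c x) *v h) $ j = grad (\<lambda>y. c y $ j) x \<bullet> h" for h
      by (simp add: matrix_vector_mult_def transpose_def grad_vec_def inner_vec_def)
    ultimately show ?thesis using has_derivative_grad by simp
  qed
  then show ?thesis
    by (subst has_derivative_componentwise_within) (auto simp: Basis_vec_def inner_axis)
qed

lemma norm_mult_spectral_le:
  fixes A :: "real^'m^'n"
  assumes "spectral_norm A \<le> B"
  shows "norm (A *v u) \<le> B * norm u"
proof -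
  have "norm (A *v u) \<le> spectral_norm A * norm u"
    unfolding spectral_norm_def by (rule onorm) (rule matrix_vector_mul_bounded_linear)
  also have "\<dots> \<le> B * norm u" using assms by (intro mult_right_mono) auto
  finally show ?thesis .
qed

text \<open>Pairing the image with itself moves the matrix to the other factor, so the bound for
  \<open>A\<close> carries over after cancelling one norm.\<close>

lemma norm_transpose_mult_spectral_le:
  fixes A :: "real^'m^'n"
  assumes "spectral_norm A \<le> B"
  shows "norm (transpose A *v v) \<le> B * norm v"
proof (cases "transpose A *v v = 0")
  case True
  have "0 \<le> B"
    using assms onorm_pos_le[OF matrix_vector_mul_bounded_linear[of A]]
    by (simp add: spectral_norm_def)
  then show ?thesis using True by simp
next
  case False
  let ?w = "transpose A *v v"
  have "norm ?w * norm ?w = v \<bullet> (A *v ?w)"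
    by (simp add: dot_lmul_matrix[symmetric] power2_norm_eq_inner flip: power2_eq_square)
  also have "\<dots> \<le> norm v * norm (A *v ?w)" by (rule norm_cauchy_schwarz)
  also have "\<dots> \<le> norm v * (B * norm ?w)"
    by (intro mult_left_mono norm_mult_spectral_le assms) auto
  finally show ?thesis using False by (simp add: mult.commute)
qed

text \<open>The hypotheses concern only the segment from \<open>x\<close> to \<open>x + h\<close>,
  because \<open>U\<close> need not be convex. Pairing with the error vector reduces a vector-valued
  \<open>F\<close> to a monotonicity argument in one real variable.\<close>

lemma taylor_lipschitz_derivative:
  fixes F :: "'a::real_normed_vector \<Rightarrow> 'b::real_inner"
  assumes deriv: "\<And>t. t \<in> {0..1} \<Longrightarrow> (F has_derivative F' (x + t *\<^sub>R h)) (at (x + t *\<^sub>R h))"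
    and lip: "\<And>t. t \<in> {0..1} \<Longrightarrow> norm (F' (x + t *\<^sub>R h) h - F' x h) \<le> L * t * (norm h)\<^sup>2"
  shows "norm (F (x + h) - F x - F' x h) \<le> L / 2 * (norm h)\<^sup>2"
proof -
  define e where "e = F (x + h) - F x - F' x h"
  \<comment> \<open>The derivative of the subtracted quadratic is \<open>norm e\<close> times the
    Lipschitz bound, which makes \<open>\<phi>\<close> nonincreasing.\<close>
  define \<phi> where "\<phi> t = e \<bullet> (F (x + t *\<^sub>R h) - t *\<^sub>R F' x h) - norm e * (L / 2 * (norm h)\<^sup>2) * t\<^sup>2" for t
  have "\<phi> 1 \<le> \<phi> 0"
  proof (rule DERIV_nonpos_imp_nonincreasing[where f = \<phi> and a = 0 and b = 1])
    fix t :: real assume t: "0 \<le> t" "t \<le> 1"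
    let ?y = "x + t *\<^sub>R h"
    have line: "((\<lambda>t. x + t *\<^sub>R h) has_derivative (\<lambda>s. s *\<^sub>R h)) (at t)"
      by (auto intro!: derivative_eq_intros)
    have lin: "linear (F' ?y)" using deriv[of t] t has_derivative_linear by auto
    have "((\<lambda>t. F (x + t *\<^sub>R h)) has_derivative (\<lambda>s. F' ?y (s *\<^sub>R h))) (at t)"
      using has_derivative_compose[OF line] deriv[of t] t by auto
    then have "((\<lambda>t. F (x + t *\<^sub>R h)) has_vector_derivative F' ?y h) (at t)"
      by (simp add: has_vector_derivative_def linear_cmul[OF lin])
    then have "((\<lambda>t. F (x + t *\<^sub>R h) - t *\<^sub>R F' x h) has_vector_derivative (F' ?y h - F' x h)) (at t)"
      by (auto intro!: derivative_eq_intros)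
    then have "((\<lambda>t. e \<bullet> (F (x + t *\<^sub>R h) - t *\<^sub>R F' x h)) has_real_derivative e \<bullet> (F' ?y h - F' x h)) (at t)"
      unfolding has_real_derivative_iff_has_vector_derivative
      by (rule bounded_linear.has_vector_derivative[OF bounded_linear_inner_right])
    then have "(\<phi> has_real_derivative e \<bullet> (F' ?y h - F' x h) - norm e * (L / 2 * (norm h)\<^sup>2) * (2 * t)) (at t)"
      unfolding \<phi>_def by (auto intro!: derivative_eq_intros)
    moreover have "e \<bullet> (F' ?y h - F' x h) \<le> norm e * (L * t * (norm h)\<^sup>2)"
      using norm_cauchy_schwarz[of e "F' ?y h - F' x h"] mult_left_mono[OF lip[of t], of "norm e"] t
      by auto
    ultimately show "\<exists>y. DERIV \<phi> t :> y \<and> y \<le> 0"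
      by (intro exI conjI) (auto simp: algebra_simps)
  qed auto
  then have "e \<bullet> (F (x + h) - F x - F' x h) \<le> norm e * (L / 2 * (norm h)\<^sup>2)"
    by (simp add: \<phi>_def inner_diff_right)
  then have "norm e * norm e \<le> norm e * (L / 2 * (norm h)\<^sup>2)"
    unfolding e_def[symmetric] by (simp add: power2_norm_eq_inner flip: power2_eq_square)
  \<comment> \<open>The sign of \<open>L\<close> is not assumed; the Lipschitz bound at
    \<open>t = 1\<close> settles the case \<open>e = 0\<close>.\<close>
  moreover have "0 \<le> L / 2 * (norm h)\<^sup>2"
    using order_trans[OF norm_ge_zero lip[of 1]] by simp
  ultimately show ?thesis
    unfolding e_def[symmetric] by (cases "e = 0") auto
qed

lemma power2_norm_add:
  fixes a b :: "'a::real_inner"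
  shows "(norm (a + b))\<^sup>2 = (norm a)\<^sup>2 + 2 * (a \<bullet> b) + (norm b)\<^sup>2"
  by (simp add: power2_norm_eq_inner inner_add_left inner_add_right inner_commute)

section \<open>The iteration\<close>

locale nr_lalm =
  fixes f :: "real^'n \<Rightarrow> real" and c :: "real^'n \<Rightarrow> real^'m"
    and U :: "(real^'n) set" and r :: reg_consts and q :: alg_params
    and x0 :: "real^'n" and l0 :: "real^'m"
    and x :: "nat \<Rightarrow> real^'n" and l :: "nat \<Rightarrow> real^'m" and p :: "nat \<Rightarrow> real^'n"
  assumes regularity: "regularity f c U r"
    and parameters: "parameter_cond c r q x0 l0"
    and localization: "closed_nbhd (Del q) (S_det f c r q x0) \<subseteq> U"
    and run: "NR_LALM f c q x0 l0 x l p"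
begin

abbreviation "g \<equiv> grad f"
abbreviation "A \<equiv> grad_vec c"
abbreviation "\<beta> \<equiv> beta q"
abbreviation "\<rho> \<equiv> rho q"
abbreviation "\<Delta> \<equiv> Del q"
abbreviation "\<Lambda> \<equiv> Lam q"
abbreviation "\<sigma> \<equiv> sig_c r"
abbreviation "\<kappa> \<equiv> kappa_lin r"
abbreviation "S \<equiv> S_det f c r q x0"
abbreviation "\<Phi> \<equiv> Phi f c r q x l p"
abbreviation "R k \<equiv> KKT_residual f c (x k) (l k)"

definition lin_err :: "nat \<Rightarrow> real^'m" where
  "lin_err k = c (x (Suc k)) - c (x k) - transpose (A (x k)) *v p k"

text \<open>This is the induction invariant. Through the localization assumption, membership in
  \<open>S\<close> leaves room in \<open>U\<close> for a step of length at most
  \<open>\<Delta>\<close>.\<close>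

definition admissible :: "nat \<Rightarrow> bool" where
  "admissible k \<longleftrightarrow> x k \<in> S \<and> norm (l k) \<le> \<Lambda>"

lemma positive [simp]:
  "0 < \<beta>" "0 < \<rho>" "0 < \<Delta>" "0 < \<Lambda>"
  "0 < G_f r" "0 < L_f r" "0 < M_c r" "0 < L_c r" "0 < \<sigma>" "0 < \<kappa>"
  using parameters regularity by (auto simp: parameter_cond_def regularity_def kappa_lin_def)

lemma nonneg [simp]:
  "0 \<le> \<beta>" "0 \<le> \<rho>" "0 \<le> \<Delta>" "0 \<le> \<Lambda>"
  "0 \<le> G_f r" "0 \<le> L_f r" "0 \<le> M_c r" "0 \<le> L_c r" "0 \<le> \<sigma>" "0 \<le> \<kappa>"
  by (simp_all add: less_imp_le)

lemma nonzero [simp]: "\<beta> \<noteq> 0" "\<rho> \<noteq> 0" "\<sigma> \<noteq> 0"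
  using positive by fastforce+

lemma x_Suc: "x (Suc k) = x k + p k"
  and l_Suc: "l (Suc k) = l k + \<rho> *\<^sub>R c (x (Suc k))"
  and system: "system_matrix c q (x k) *v p k = system_rhs f c q (x k) (l k)"
  using run by (auto simp: NR_LALM_def)

lemma norm_g_le: "y \<in> U \<Longrightarrow> norm (g y) \<le> G_f r"
  and f_lower: "y \<in> U \<Longrightarrow> f_low r \<le> f y"
  and g_lipschitz: "y \<in> U \<Longrightarrow> z \<in> U \<Longrightarrow> norm (g y - g z) \<le> L_f r * norm (y - z)"
  and A_inj: "y \<in> U \<Longrightarrow> \<sigma> * norm u \<le> norm (A y *v u)"
  and A_spectral: "y \<in> U \<Longrightarrow> spectral_norm (A y) \<le> M_c r"
  and A_lipschitz: "y \<in> U \<Longrightarrow> z \<in> U \<Longrightarrow> spectral_norm (A y - A z) \<le> L_c r * norm (y - z)"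
  using regularity by (auto simp: regularity_def)

lemmas norm_A_le = norm_mult_spectral_le[OF A_spectral]
lemmas norm_At_le = norm_transpose_mult_spectral_le[OF A_spectral]

lemma nbhd_S: "y \<in> S \<Longrightarrow> norm h \<le> \<Delta> \<Longrightarrow> y + h \<in> U"
  using localization infdist_le2[of y S "y + h" \<Delta>]
  by (auto simp: closed_nbhd_def dist_norm)

lemma S_in_U: "y \<in> S \<Longrightarrow> y \<in> U"
  using nbhd_S[of y 0] by simp

section \<open>The regularized linear system\<close>

lemma system_matrix_mult:
  "system_matrix c q y *v v = \<beta> *\<^sub>R v + \<rho> *\<^sub>R (A y *v (transpose (A y) *v v))"
  by (simp add: system_matrix_def matrix_vector_mult_add_rdistrib
      scaleR_matrix_vector_assoc[symmetric] matrix_vector_mul_assoc[symmetric])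

text \<open>By the push-through identity
  \<open>(\<beta> I + \<rho> A A\<^sup>T)\<^sup>-\<^sup>1 A = A (\<beta> I + \<rho> A\<^sup>T A)\<^sup>-\<^sup>1\<close>, the part of the step caused by the
  constraints is controlled by the smallest singular value of \<open>A\<close>.\<close>

lemma linear_system_bound:
  assumes y: "y \<in> U" and sol: "system_matrix c q y *v v = b + A y *v w"
  shows "norm v \<le> norm b / \<beta> + M_c r * norm w / (\<beta> + \<rho> * \<sigma>\<^sup>2)"
proof -
  have quad: "v \<bullet> (system_matrix c q y *v v) = \<beta> * (norm v)\<^sup>2 + \<rho> * (norm (transpose (A y) *v v))\<^sup>2" for v
    by (simp add: system_matrix_mult inner_right_distrib dot_lmul_matrix[symmetric] power2_norm_eq_inner)
  \<comment> \<open>The solution is split by right-hand side: the part from \<open>b\<close> sees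
    only the coercivity constant \<open>\<beta>\<close>, the part from \<open>A y *v w\<close> the
    larger \<open>\<beta> + \<rho> * \<sigma>\<^sup>2\<close>.\<close>
  obtain s where s: "system_matrix c q y *v s = b"
    using system_matrix_ex1[of q c y b] by auto
  define t where "t = v - s"
  have t: "system_matrix c q y *v t = A y *v w"
    by (simp add: t_def matrix_vector_mult_diff_distrib sol s)
  have "norm s \<le> norm b / \<beta>"
  proof (cases "s = 0")
    case False
    have "\<beta> * (norm s)\<^sup>2 \<le> s \<bullet> b" using quad[of s] s by simp
    also have "\<dots> \<le> norm s * norm b" by (rule norm_cauchy_schwarz)
    finally have "\<beta> * norm s \<le> norm b" using False by (simp add: power2_eq_square)
    then show ?thesis by (simp add: pos_le_divide_eq mult.commute)
  qed simp
  moreover have "norm t \<le> M_c r * norm w / (\<beta> + \<rho> * \<sigma>\<^sup>2)"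
  proof -
    \<comment> \<open>This is the solution of the system with matrix
      \<open>\<beta> I + \<rho> A\<^sup>T A\<close> and right-hand side \<open>w\<close>, written
      explicitly through \<open>t\<close>.\<close>
    define z where "z = (1 / \<beta>) *\<^sub>R (w - \<rho> *\<^sub>R (transpose (A y) *v t))"
    have "A y *v z = (1 / \<beta>) *\<^sub>R (A y *v w - \<rho> *\<^sub>R (A y *v (transpose (A y) *v t)))"
      by (simp add: z_def matrix_vector_mult_scaleR matrix_vector_mult_diff_distrib)
    also have "\<dots> = (1 / \<beta>) *\<^sub>R (\<beta> *\<^sub>R t)"
      unfolding t[symmetric] system_matrix_mult by (simp only: add_diff_cancel_right')
    finally have Az: "A y *v z = t" by simp
    have "w = \<beta> *\<^sub>R z + \<rho> *\<^sub>R (transpose (A y) *v (A y *v z))"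
      unfolding Az by (simp add: z_def)
    then have "z \<bullet> w = \<beta> * (norm z)\<^sup>2 + \<rho> * (z \<bullet> (transpose (A y) *v (A y *v z)))"
      by (simp add: inner_right_distrib power2_norm_eq_inner)
    also have "z \<bullet> (transpose (A y) *v (A y *v z)) = (norm (A y *v z))\<^sup>2"
      using dot_lmul_matrix[of z "transpose (A y)" "A y *v z"]
      by (simp add: power2_norm_eq_inner)
    finally have "\<beta> * (norm z)\<^sup>2 + \<rho> * (norm (A y *v z))\<^sup>2 = z \<bullet> w" ..
    moreover have "(\<sigma> * norm z)\<^sup>2 \<le> (norm (A y *v z))\<^sup>2"
      using A_inj[OF y] by (intro power_mono) auto
    then have "\<rho> * (\<sigma> * norm z)\<^sup>2 \<le> \<rho> * (norm (A y *v z))\<^sup>2"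
      by (intro mult_left_mono) auto
    moreover have "(\<beta> + \<rho> * \<sigma>\<^sup>2) * (norm z)\<^sup>2 = \<beta> * (norm z)\<^sup>2 + \<rho> * (\<sigma> * norm z)\<^sup>2"
      by (simp add: algebra_simps power_mult_distrib)
    ultimately have "(\<beta> + \<rho> * \<sigma>\<^sup>2) * (norm z)\<^sup>2 \<le> norm z * norm w"
      using norm_cauchy_schwarz[of z w] by linarith
    moreover have pos: "0 < \<beta> + \<rho> * \<sigma>\<^sup>2" by (intro add_pos_nonneg) auto
    ultimately have "(\<beta> + \<rho> * \<sigma>\<^sup>2) * norm z \<le> norm w"
      by (cases "z = 0") (auto simp: power2_eq_square)
    then have "norm z \<le> norm w / (\<beta> + \<rho> * \<sigma>\<^sup>2)"
      using pos by (simp add: pos_le_divide_eq mult.commute)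
    then have "M_c r * norm z \<le> M_c r * (norm w / (\<beta> + \<rho> * \<sigma>\<^sup>2))"
      by (intro mult_left_mono) auto
    then show ?thesis using norm_A_le[OF y, of z] by (simp add: Az)
  qed
  ultimately show ?thesis
    using norm_triangle_ineq[of s t] by (simp add: t_def)
qed

section \<open>Stationarity and identities for the augmented Lagrangian\<close>

lemma A_p_nonneg: "0 \<le> A_p r q"
  by (simp add: A_p_def)

lemma optimality:
  "\<beta> *\<^sub>R p k + \<rho> *\<^sub>R (A (x k) *v (transpose (A (x k)) *v p k))
    = - g (x k) - A (x k) *v l k - \<rho> *\<^sub>R (A (x k) *v c (x k))"
  using system[of k]
  by (simp add: system_matrix_mult system_rhs_def matrix_vector_right_distrib matrix_vector_mult_scaleR)

text \<open>The linear system contains \<open>l k\<close> plus \<open>\<rho>\<close> times the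
  linearized constraint, while the multiplier update uses the true value at the new point. The two
  differ by \<open>\<rho>\<close> times \<open>lin_err k\<close>.\<close>

lemma stationarity: "A (x k) *v l (Suc k) = (\<rho> *\<^sub>R (A (x k) *v lin_err k) - \<beta> *\<^sub>R p k) - g (x k)"
proof -
  have "l (Suc k) = l k + \<rho> *\<^sub>R (c (x k) + transpose (A (x k)) *v p k + lin_err k)"
    by (simp add: l_Suc lin_err_def)
  then have "A (x k) *v l (Suc k) = A (x k) *v l k + \<rho> *\<^sub>R (A (x k) *v c (x k))
      + \<rho> *\<^sub>R (A (x k) *v (transpose (A (x k)) *v p k)) + \<rho> *\<^sub>R (A (x k) *v lin_err k)"
    by (simp add: matrix_vector_right_distrib matrix_vector_mult_scaleR scaleR_add_right)
  then show ?thesis using optimality by (simp add: algebra_simps)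
qed

text \<open>The update makes the new constraint value equal to the multiplier increment divided by
  \<open>\<rho>\<close>.\<close>

lemma dual_ascent:
  "aug_lagrangian f c \<rho> (x (Suc k)) (l (Suc k))
    = aug_lagrangian f c \<rho> (x (Suc k)) (l k) + (norm (l (Suc k) - l k))\<^sup>2 / \<rho>"
  by (simp add: aug_lagrangian_def l_Suc inner_add_left power_mult_distrib power2_norm_eq_inner
      power2_eq_square[of "rho q"])

text \<open>Completing the square in \<open>u + \<rho> *\<^sub>R c y\<close>. This is the source of
  the term \<open>\<Lambda>\<^sup>2 / (2 * \<rho>)\<close> in \<open>H_det\<close> and
  \<open>Phi_low\<close>.\<close>

lemma f_le_aug_lagrangian: "f y \<le> aug_lagrangian f c \<rho> y u + (norm u)\<^sup>2 / (2 * \<rho>)"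
proof -
  have "0 \<le> (norm (u + \<rho> *\<^sub>R c y))\<^sup>2 / (2 * \<rho>)" by simp
  also have "\<dots> = u \<bullet> c y + \<rho> / 2 * (norm (c y))\<^sup>2 + (norm u)\<^sup>2 / (2 * \<rho>)"
    unfolding power2_norm_add by (simp add: power_mult_distrib add_divide_distrib power2_eq_square[of "rho q"])
  finally show ?thesis by (simp add: aug_lagrangian_def)
qed

lemma C_lam_p_nonneg: "0 \<le> C_lam_p r q"
  by (simp add: C_lam_p_def le_max_iff_disj)

section \<open>Estimates for one step from an admissible iterate\<close>

context
  fixes k assumes adm: "admissible k"
begin

lemma xU: "x k \<in> U" and xS: "x k \<in> S"
  using adm S_in_U by (auto simp: admissible_def)

lemma norm_c_le: "\<rho> * norm (c (x k)) \<le> 2 * \<Lambda>"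
  using xS by (simp add: S_det_def pos_le_divide_eq mult.commute)

lemma norm_l_le: "norm (l k) \<le> \<Lambda>"
  using adm by (simp add: admissible_def)

lemma norm_shifted_multiplier_le: "norm (l k + \<rho> *\<^sub>R c (x k)) \<le> 3 * \<Lambda>"
  using norm_triangle_ineq[of "l k" "\<rho> *\<^sub>R c (x k)"] norm_c_le norm_l_le by simp

text \<open>\<open>linear_system_bound\<close> with the negated shifted multiplier as
  \<open>w\<close> leads exactly to the second inequality on constants in
  \<open>parameter_cond\<close>.\<close>

lemma norm_p_le: "norm (p k) \<le> \<Delta>"
proof -
  let ?w = "l k + \<rho> *\<^sub>R c (x k)"
  have pos: "0 < \<beta> + \<rho> * \<sigma>\<^sup>2" by (intro add_pos_nonneg) auto
  have "system_matrix c q (x k) *v p k = - g (x k) + A (x k) *v (- ?w)"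
    by (simp add: system system_rhs_def linear_neg[OF matrix_vector_mul_linear] del: minus_add_distrib)
  from linear_system_bound[OF xU this]
  have "norm (p k) \<le> norm (g (x k)) / \<beta> + M_c r * norm ?w / (\<beta> + \<rho> * \<sigma>\<^sup>2)"
    by (simp only: norm_minus_cancel)
  also have "\<dots> \<le> G_f r / \<beta> + M_c r * (3 * \<Lambda>) / (\<beta> + \<rho> * \<sigma>\<^sup>2)"
    using pos norm_g_le[OF xU] norm_shifted_multiplier_le
    by (intro add_mono divide_right_mono mult_left_mono) auto
  also have "\<dots> \<le> \<Delta>" using parameters by (simp add: parameter_cond_def mult_ac)
  finally show ?thesis .
qed

lemma segment_in_U:
  assumes "t \<in> {0..1}" shows "x k + t *\<^sub>R p k \<in> U"
proof -
  have "t * norm (p k) \<le> 1 * norm (p k)" using assms by (intro mult_right_mono) auto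
  then show ?thesis using assms norm_p_le by (intro nbhd_S[OF xS]) auto
qed

lemma xU_Suc: "x (Suc k) \<in> U"
  using segment_in_U[of 1] by (simp add: x_Suc)

lemma norm_lin_err_le: "norm (lin_err k) \<le> \<kappa> * (norm (p k))\<^sup>2"
proof -
  have "norm (c (x k + p k) - c (x k) - transpose (A (x k)) *v p k) \<le> L_c r / 2 * (norm (p k))\<^sup>2"
  proof (rule taylor_lipschitz_derivative[where F' = "\<lambda>y h. transpose (A y) *v h"])
    fix t :: real assume t: "t \<in> {0..1}"
    show "(c has_derivative (*v) (transpose (A (x k + t *\<^sub>R p k)))) (at (x k + t *\<^sub>R p k))"
      using segment_in_U[OF t] regularity
      by (intro has_derivative_grad_vec) (auto simp: regularity_def)
    have "transpose (A (x k + t *\<^sub>R p k)) *v p k - transpose (A (x k)) *v p k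
        = transpose (A (x k + t *\<^sub>R p k) - A (x k)) *v p k"
      by (simp add: vec_eq_iff matrix_vector_mult_def transpose_def sum_subtractf left_diff_distrib)
    then show "norm (transpose (A (x k + t *\<^sub>R p k)) *v p k - transpose (A (x k)) *v p k)
        \<le> L_c r * t * (norm (p k))\<^sup>2"
      using norm_transpose_mult_spectral_le[OF A_lipschitz[OF segment_in_U[OF t] xU], of "p k"] t
      by (simp add: power2_eq_square mult_ac)
  qed
  then show ?thesis by (simp add: lin_err_def x_Suc kappa_lin_def)
qed

text \<open>One factor \<open>norm (p k)\<close> is traded for \<open>\<Delta>\<close>, so that the
  error can be added to terms linear in the step.\<close>

lemma norm_lin_err_le_linear: "norm (lin_err k) \<le> \<kappa> * \<Delta> * norm (p k)"
proof -
  have "\<kappa> * (norm (p k))\<^sup>2 \<le> \<kappa> * (\<Delta> * norm (p k))"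
    unfolding power2_eq_square using norm_p_le by (intro mult_left_mono mult_right_mono) auto
  then show ?thesis using norm_lin_err_le unfolding mult.assoc by linarith
qed

lemma norm_A_lin_err_le: "norm (\<rho> *\<^sub>R (A (x k) *v lin_err k)) \<le> \<rho> * M_c r * \<kappa> * \<Delta> * norm (p k)"
proof -
  have "norm (A (x k) *v lin_err k) \<le> M_c r * (\<kappa> * \<Delta> * norm (p k))"
    by (rule order_trans[OF norm_A_le[OF xU] mult_left_mono[OF norm_lin_err_le_linear nonneg(7)]])
  then have "\<rho> * norm (A (x k) *v lin_err k) \<le> \<rho> * (M_c r * (\<kappa> * \<Delta> * norm (p k)))"
    by (intro mult_left_mono) auto
  then show ?thesis by (simp add: mult_ac)
qed

lemma f_upper: "f (x (Suc k)) \<le> f (x k) + g (x k) \<bullet> p k + L_f r / 2 * (norm (p k))\<^sup>2"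
proof -
  have "norm (f (x k + p k) - f (x k) - g (x k) \<bullet> p k) \<le> L_f r / 2 * (norm (p k))\<^sup>2"
  proof (rule taylor_lipschitz_derivative[where F' = "\<lambda>y h. g y \<bullet> h"])
    fix t :: real assume t: "t \<in> {0..1}"
    show "(f has_derivative (\<bullet>) (g (x k + t *\<^sub>R p k))) (at (x k + t *\<^sub>R p k))"
      using segment_in_U[OF t] regularity
      by (intro has_derivative_grad) (auto simp: regularity_def)
    have "\<bar>(g (x k + t *\<^sub>R p k) - g (x k)) \<bullet> p k\<bar> \<le> norm (g (x k + t *\<^sub>R p k) - g (x k)) * norm (p k)"
      by (rule Cauchy_Schwarz_ineq2)
    also have "\<dots> \<le> L_f r * norm (t *\<^sub>R p k) * norm (p k)"
      using g_lipschitz[OF segment_in_U[OF t] xU] by (intro mult_right_mono) auto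
    finally show "norm (g (x k + t *\<^sub>R p k) \<bullet> p k - g (x k) \<bullet> p k) \<le> L_f r * t * (norm (p k))\<^sup>2"
      using t by (simp add: power2_eq_square inner_diff_left mult_ac)
  qed
  then show ?thesis unfolding x_Suc real_norm_def by linarith
qed

text \<open>The mean value inequality replaces \<open>f_upper\<close> here, since
  \<open>Phi1_bar\<close> allows only an increase of \<open>G_f r * \<Delta>\<close>.\<close>

lemma f_increment_le: "f (x (Suc k)) \<le> f (x k) + G_f r * \<Delta>"
proof -
  let ?T = "closed_segment (x k) (x k + p k)"
  have T: "y \<in> U" if "y \<in> ?T" for y
    using that segment_in_U by (auto simp: in_segment algebra_simps)
  have "norm (f (x k + p k) - f (x k)) \<le> G_f r * norm (x k + p k - x k)"
  proof (rule differentiable_bound[where S = ?T and f' = "\<lambda>y h. g y \<bullet> h"])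
    show "(f has_derivative (\<bullet>) (g y)) (at y within ?T)" if "y \<in> ?T" for y
      using T[OF that] regularity
      by (intro has_derivative_at_withinI[OF has_derivative_grad]) (auto simp: regularity_def)
    show "onorm ((\<bullet>) (g y)) \<le> G_f r" if "y \<in> ?T" for y
    proof (rule onorm_bound)
      show "norm (g y \<bullet> h) \<le> G_f r * norm h" for h
        using Cauchy_Schwarz_ineq2[of "g y" h] mult_right_mono[OF norm_g_le[OF T[OF that]], of "norm h"]
        by simp
    qed simp
  qed auto
  also have "\<dots> \<le> G_f r * \<Delta>" using norm_p_le by (intro mult_left_mono) auto
  finally show ?thesis by (simp add: x_Suc)
qed

lemma norm_stationarity_le:
  "norm (\<rho> *\<^sub>R (A (x k) *v lin_err k) - \<beta> *\<^sub>R p k) \<le> A_p r q * norm (p k)"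
proof -
  have "norm (\<beta> *\<^sub>R p k) = \<beta> * norm (p k)" by simp
  then show ?thesis
    using norm_triangle_ineq4[of "\<rho> *\<^sub>R (A (x k) *v lin_err k)" "\<beta> *\<^sub>R p k"] norm_A_lin_err_le
    unfolding A_p_def distrib_right by linarith
qed

text \<open>Stationarity bounds the image of the new multiplier under \<open>A (x k)\<close>, and
  injectivity transfers this to the multiplier itself. The bound does not accumulate increments, so
  it is the same in every iteration.\<close>

lemma norm_l_Suc_le: "norm (l (Suc k)) \<le> \<Lambda>"
proof -
  have "norm (A (x k) *v l (Suc k)) \<le> norm (\<rho> *\<^sub>R (A (x k) *v lin_err k) - \<beta> *\<^sub>R p k) + norm (g (x k))"
    unfolding stationarity by (rule norm_triangle_ineq4)
  also have "\<dots> \<le> A_p r q * \<Delta> + G_f r"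
    using norm_stationarity_le mult_left_mono[OF norm_p_le A_p_nonneg] norm_g_le[OF xU] by linarith
  finally have "\<sigma> * norm (l (Suc k)) \<le> A_p r q * \<Delta> + G_f r"
    using A_inj[OF xU, of "l (Suc k)"] by linarith
  then have "norm (l (Suc k)) \<le> (G_f r + \<beta> * \<Delta> + \<rho> * M_c r * \<kappa> * \<Delta>\<^sup>2) / \<sigma>"
    by (simp add: pos_le_divide_eq A_p_def algebra_simps power2_eq_square)
  then show ?thesis using parameters by (auto simp: parameter_cond_def)
qed

lemma norm_c_Suc_le: "\<rho> * norm (c (x (Suc k))) \<le> 2 * \<Lambda>"
proof -
  have "\<rho> * norm (c (x (Suc k))) = norm (l (Suc k) - l k)" by (simp add: l_Suc)
  also have "\<dots> \<le> norm (l (Suc k)) + norm (l k)" by (rule norm_triangle_ineq4)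
  finally show ?thesis using norm_l_Suc_le norm_l_le by linarith
qed

text \<open>The linearized model decreases by at least
  \<open>\<beta> * (norm (p k))\<^sup>2\<close>. The Taylor remainders of \<open>f\<close> and
  \<open>c\<close> cost at most \<open>C_mod r q\<close> times the squared step, and
  \<open>C_mod r q \<le> 3 * \<beta> / 8\<close> leaves the factor 5/8.\<close>

lemma primal_descent:
  "aug_lagrangian f c \<rho> (x (Suc k)) (l k)
    \<le> aug_lagrangian f c \<rho> (x k) (l k) - 5 * \<beta> / 8 * (norm (p k))\<^sup>2"
proof -
  define a where "a = transpose (A (x k)) *v p k"
  define e where "e = lin_err k"
  define P where "P = (norm (p k))\<^sup>2"
  have c_Suc: "c (x (Suc k)) = (c (x k) + a) + e" by (simp add: a_def e_def lin_err_def)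
  have move: "(A (x k) *v u) \<bullet> p k = u \<bullet> a" for u
    using dot_lmul_matrix[of "p k" "A (x k)" u] by (simp add: a_def inner_commute)
  \<comment> \<open>The linear system is tested against the step \<open>p k\<close>.\<close>
  have model: "g (x k) \<bullet> p k + l k \<bullet> a + \<rho> * (c (x k) \<bullet> a) = - (\<beta> * P) - \<rho> * (norm a)\<^sup>2"
    using arg_cong[OF optimality[of k], of "\<lambda>v. v \<bullet> p k"]
    unfolding a_def[symmetric]
    by (simp add: inner_add_left inner_diff_left move P_def power2_norm_eq_inner)
  have e: "norm e \<le> \<kappa> * P" using norm_lin_err_le by (simp add: e_def P_def)
  have "norm a \<le> M_c r * \<Delta>"
    unfolding a_def by (rule order_trans[OF norm_At_le[OF xU] mult_left_mono[OF norm_p_le nonneg(7)]])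
  then have "norm (\<rho> *\<^sub>R a) \<le> \<rho> * (M_c r * \<Delta>)" by (simp add: mult_left_mono)
  moreover have "norm (\<rho> *\<^sub>R a) = \<rho> * norm a" by simp
  ultimately have w: "norm ((l k + \<rho> *\<^sub>R c (x k)) + \<rho> *\<^sub>R a) \<le> 3 * \<Lambda> + \<rho> * M_c r * \<Delta>"
    using norm_triangle_ineq[of "l k + \<rho> *\<^sub>R c (x k)" "\<rho> *\<^sub>R a"] norm_shifted_multiplier_le
    unfolding mult.assoc by linarith
  have "((l k + \<rho> *\<^sub>R c (x k)) + \<rho> *\<^sub>R a) \<bullet> e \<le> (3 * \<Lambda> + \<rho> * M_c r * \<Delta>) * (\<kappa> * P)"
    using mult_mono[OF w e] norm_cauchy_schwarz[of "(l k + \<rho> *\<^sub>R c (x k)) + \<rho> *\<^sub>R a" e]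
    by (simp add: add_nonneg_nonneg)
  then have cross: "l k \<bullet> e + \<rho> * ((c (x k) + a) \<bullet> e) \<le> (3 * \<Lambda> + \<rho> * M_c r * \<Delta>) * (\<kappa> * P)"
    by (simp add: inner_add_left algebra_simps)
  \<comment> \<open>The linear error bound keeps this term quadratic in the step and yields the last
    summand of \<open>C_mod\<close>.\<close>
  have "(norm e)\<^sup>2 \<le> (\<kappa> * \<Delta> * norm (p k))\<^sup>2"
    using norm_lin_err_le_linear by (intro power_mono) (auto simp: e_def)
  then have "\<rho> / 2 * (norm e)\<^sup>2 \<le> \<rho> / 2 * (\<kappa>\<^sup>2 * \<Delta>\<^sup>2 * P)"
    by (intro mult_left_mono) (auto simp: power_mult_distrib P_def)
  moreover have "aug_lagrangian f c \<rho> (x (Suc k)) (l k) - aug_lagrangian f c \<rho> (x k) (l k)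
      = f (x (Suc k)) - f (x k) + l k \<bullet> a + \<rho> * (c (x k) \<bullet> a) + \<rho> / 2 * (norm a)\<^sup>2
        + (l k \<bullet> e + \<rho> * ((c (x k) + a) \<bullet> e)) + \<rho> / 2 * (norm e)\<^sup>2"
    unfolding aug_lagrangian_def c_Suc power2_norm_add
    by (simp add: inner_add_right inner_add_left algebra_simps)
  \<comment> \<open>The model supplies \<open>- \<rho> * (norm a)\<^sup>2\<close>, the expansion
    only half of that with positive sign; the surplus is dropped.\<close>
  moreover have "0 \<le> \<rho> * (norm a)\<^sup>2" by simp
  ultimately have "aug_lagrangian f c \<rho> (x (Suc k)) (l k) - aug_lagrangian f c \<rho> (x k) (l k)
      \<le> - (\<beta> * P) + L_f r / 2 * P + (3 * \<Lambda> + \<rho> * M_c r * \<Delta>) * (\<kappa> * P) + \<rho> / 2 * (\<kappa>\<^sup>2 * \<Delta>\<^sup>2 * P)"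
    using f_upper model cross unfolding P_def[symmetric] by linarith
  also have "\<dots> = (C_mod r q - \<beta>) * P"
    by (simp add: C_mod_def algebra_simps)
  also have "\<dots> \<le> (3 * \<beta> / 8 - \<beta>) * P"
    using parameters by (intro mult_right_mono) (auto simp: parameter_cond_def P_def)
  finally show ?thesis by (simp add: P_def algebra_simps)
qed

end

section \<open>The Lyapunov function and its first value\<close>

text \<open>This serves twice: an upper bound on \<open>\<Phi>\<close> keeps iterates in the
  sublevel set of \<open>f\<close>, and the lower bound on \<open>f\<close> bounds
  \<open>\<Phi>\<close> below.\<close>

lemma f_le_Phi:
  assumes "norm (l k) \<le> \<Lambda>"
  shows "f (x k) \<le> \<Phi> k + \<Lambda>\<^sup>2 / (2 * \<rho>)"
proof -
  have "(norm (l k))\<^sup>2 / (2 * \<rho>) \<le> \<Lambda>\<^sup>2 / (2 * \<rho>)"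
    using assms by (intro divide_right_mono power_mono) auto
  moreover have "0 \<le> C_lam_p r q / \<rho> * (norm (p (k - 1)))\<^sup>2" using C_lam_p_nonneg by simp
  ultimately show ?thesis using f_le_aug_lagrangian[of "x k" "l k"] by (simp add: Phi_def)
qed

lemma admissible_0: "admissible 0"
proof -
  have x0: "x 0 = x0" "l 0 = l0" using run by (auto simp: NR_LALM_def)
  have "\<rho> * norm (c x0) \<le> 2 * \<Lambda>" using parameters nonneg(4) unfolding parameter_cond_def by linarith
  moreover have "f x0 \<le> H_det f r q x0"
    using C_lam_p_nonneg by (simp add: H_det_def Phi1_bar_def add_nonneg_nonneg)
  ultimately show ?thesis
    using parameters
    by (simp add: admissible_def S_det_def x0 parameter_cond_def pos_le_divide_eq mult.commute)
qed

text \<open>Descent of \<open>\<Phi>\<close> starts only at index 1, so this value is bounded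
  directly from the initial data.\<close>

lemma Phi_1_le: "\<Phi> 1 \<le> Phi1_bar f r q x0"
proof -
  note adm = admissible_0
  have x0: "x 0 = x0" using run by (auto simp: NR_LALM_def)
  have c: "norm (c (x 1)) \<le> 2 * \<Lambda> / \<rho>"
    using norm_c_Suc_le[OF adm] by (simp add: pos_le_divide_eq mult.commute)
  have "l 1 \<bullet> c (x 1) \<le> \<Lambda> * (2 * \<Lambda> / \<rho>)"
    using norm_cauchy_schwarz[of "l 1" "c (x 1)"] mult_mono[OF _ c, of "norm (l 1)" \<Lambda>]
      norm_l_Suc_le[OF adm] by simp
  moreover have "\<rho> / 2 * (norm (c (x 1)))\<^sup>2 \<le> \<rho> / 2 * (2 * \<Lambda> / \<rho>)\<^sup>2"
    using c by (intro mult_left_mono power_mono) auto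
  moreover have "\<Lambda> * (2 * \<Lambda> / \<rho>) + \<rho> / 2 * (2 * \<Lambda> / \<rho>)\<^sup>2 = 4 * \<Lambda>\<^sup>2 / \<rho>"
    using positive(2) by (simp add: field_simps power2_eq_square)
  moreover have "C_lam_p r q / \<rho> * (norm (p 0))\<^sup>2 \<le> C_lam_p r q / \<rho> * \<Delta>\<^sup>2"
    using norm_p_le[OF adm] C_lam_p_nonneg by (intro mult_left_mono power_mono) auto
  ultimately show ?thesis
    using f_increment_le[OF adm]
    unfolding Phi_def aug_lagrangian_def Phi1_bar_def One_nat_def x0 diff_self_eq_0 by linarith
qed

section \<open>Estimates for two consecutive steps\<close>

context
  fixes k assumes adm: "admissible k" and adm_Suc: "admissible (Suc k)"
begin

text \<open>Subtracting the stationarity relations of two consecutive iterations expresses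
  \<open>A (l (k + 2) - l (k + 1))\<close> in terms of the two steps.\<close>

lemma multiplier_increment_le:
  "(norm (l (Suc (Suc k)) - l (Suc k)))\<^sup>2
    \<le> C_lam_p r q / 2 * ((norm (p (Suc k)))\<^sup>2 + (norm (p k))\<^sup>2)"
proof -
  let ?s = "\<lambda>k. \<rho> *\<^sub>R (A (x k) *v lin_err k) - \<beta> *\<^sub>R p k"
  let ?d = "l (Suc (Suc k)) - l (Suc k)"
  define m where "m = max ((A_p r q)\<^sup>2) ((B_p r q)\<^sup>2)"
  have U: "x k \<in> U" "x (Suc k) \<in> U" using xU adm adm_Suc by auto
  \<comment> \<open>Stationarity at \<open>k\<close> involves \<open>A (x k)\<close>; passing to
    \<open>A (x (Suc k))\<close> produces the last term. Together with the change of the gradient it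
    explains why \<open>B_p\<close> exceeds \<open>A_p\<close>.\<close>
  have "A (x (Suc k)) *v ?d = ?s (Suc k) - ?s k - (g (x (Suc k)) - g (x k))
      - (A (x (Suc k)) - A (x k)) *v l (Suc k)"
    by (simp add: matrix_vector_mult_diff_distrib matrix_vector_mult_diff_rdistrib stationarity)
  then have "norm (A (x (Suc k)) *v ?d) \<le> norm (?s (Suc k)) + norm (?s k) + norm (g (x (Suc k)) - g (x k))
      + norm ((A (x (Suc k)) - A (x k)) *v l (Suc k))"
    by (smt (verit) norm_triangle_ineq4)
  moreover have "norm (g (x (Suc k)) - g (x k)) \<le> L_f r * norm (p k)"
    using g_lipschitz[OF U(2,1)] by (simp add: x_Suc)
  moreover have "norm ((A (x (Suc k)) - A (x k)) *v l (Suc k)) \<le> L_c r * norm (p k) * \<Lambda>"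
  proof -
    have "norm ((A (x (Suc k)) - A (x k)) *v l (Suc k)) \<le> L_c r * norm (p k) * norm (l (Suc k))"
      using norm_mult_spectral_le[OF A_lipschitz[OF U(2,1)], of "l (Suc k)"] by (simp add: x_Suc)
    also have "\<dots> \<le> L_c r * norm (p k) * \<Lambda>"
      using norm_l_le[OF adm_Suc] by (intro mult_left_mono) auto
    finally show ?thesis .
  qed
  ultimately have "norm (A (x (Suc k)) *v ?d) \<le> A_p r q * norm (p (Suc k)) + B_p r q * norm (p k)"
    using norm_stationarity_le[OF adm] norm_stationarity_le[OF adm_Suc]
    by (simp add: B_p_def algebra_simps)
  then have "(\<sigma> * norm ?d)\<^sup>2 \<le> (A_p r q * norm (p (Suc k)) + B_p r q * norm (p k))\<^sup>2"
    using A_inj[OF U(2), of ?d] by (intro power_mono) auto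
  \<comment> \<open>The factor 2 from squaring a sum, divided by \<open>\<sigma>\<^sup>2\<close>,
    gives half of \<open>C_lam_p\<close>, whose factor is 4.\<close>
  also have "\<dots> \<le> 2 * ((A_p r q)\<^sup>2 * (norm (p (Suc k)))\<^sup>2 + (B_p r q)\<^sup>2 * (norm (p k))\<^sup>2)"
    using sum_squares_bound[of "A_p r q * norm (p (Suc k))" "B_p r q * norm (p k)"]
    by (simp add: power2_sum power_mult_distrib)
  also have "\<dots> \<le> 2 * (m * (norm (p (Suc k)))\<^sup>2 + m * (norm (p k))\<^sup>2)"
    by (intro mult_left_mono add_mono mult_right_mono) (auto simp: m_def)
  finally have "\<sigma>\<^sup>2 * (norm ?d)\<^sup>2 \<le> 2 * m * ((norm (p (Suc k)))\<^sup>2 + (norm (p k))\<^sup>2)"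
    by (simp add: power_mult_distrib algebra_simps)
  then have "(norm ?d)\<^sup>2 \<le> 2 * m * ((norm (p (Suc k)))\<^sup>2 + (norm (p k))\<^sup>2) / \<sigma>\<^sup>2"
    by (simp add: pos_le_divide_eq mult.commute)
  then show ?thesis by (simp add: C_lam_p_def m_def)
qed

lemma Phi_descent: "\<Phi> (Suc (Suc k)) \<le> \<Phi> (Suc k) - \<beta> / 4 * (norm (p (Suc k)))\<^sup>2"
proof -
  define C P Q where "C = C_lam_p r q / \<rho>" and "P = (norm (p (Suc k)))\<^sup>2" and "Q = (norm (p k))\<^sup>2"
  have C: "0 \<le> C" "C \<le> \<beta> / 8"
    using parameters C_lam_p_nonneg
    by (auto simp: C_def parameter_cond_def field_simps)
  have "(norm (l (Suc (Suc k)) - l (Suc k)))\<^sup>2 / \<rho> \<le> C_lam_p r q / 2 * (P + Q) / \<rho>"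
    using multiplier_increment_le by (intro divide_right_mono) (auto simp: P_def Q_def)
  also have "\<dots> = C / 2 * (P + Q)" by (simp add: C_def)
  \<comment> \<open>The coefficient of \<open>Q\<close> is \<open>- C / 2\<close>, so the stored
    previous step pays for its share of the multiplier increment. That of \<open>P\<close> is
    \<open>- 5 * \<beta> / 8 + 3 * C / 2\<close>, at most \<open>- 7 * \<beta> / 16\<close> since
    \<open>C \<le> \<beta> / 8\<close>.\<close>
  finally have "\<Phi> (Suc (Suc k)) \<le> \<Phi> (Suc k) - 5 * \<beta> / 8 * P + C / 2 * (P + Q) + C * P - C * Q"
    using primal_descent[OF adm_Suc] dual_ascent[of "Suc k"]
    by (simp add: Phi_def C_def P_def Q_def)
  moreover have "C * P \<le> \<beta> / 8 * P" using C by (intro mult_right_mono) (auto simp: P_def)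
  moreover have "0 \<le> C * Q" "0 \<le> \<beta> * P" using C by (auto simp: P_def Q_def)
  ultimately show ?thesis unfolding P_def[symmetric] by (simp add: field_simps)
qed

text \<open>Moving the stationarity relation to the new point costs two Lipschitz terms and gives
  \<open>C_s\<close>. Feasibility is the multiplier increment divided by \<open>\<rho>\<close>,
  which gives the other summand of \<open>C_R\<close>.\<close>

lemma residual_le:
  "(R (Suc (Suc k)))\<^sup>2 \<le> C_R r q * ((norm (p (Suc k)))\<^sup>2 + (norm (p k))\<^sup>2)"
proof -
  let ?y = "x (Suc k)" and ?z = "x (Suc (Suc k))" and ?l = "l (Suc (Suc k))"
  let ?s = "\<rho> *\<^sub>R (A ?y *v lin_err (Suc k)) - \<beta> *\<^sub>R p (Suc k)"
  let ?P = "(norm (p (Suc k)))\<^sup>2 + (norm (p k))\<^sup>2"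
  have U: "?y \<in> U" "?z \<in> U" using xU xU_Suc adm_Suc by auto
  have "g ?z + A ?z *v ?l = ?s + (g ?z - g ?y) + (A ?z - A ?y) *v ?l"
    by (simp add: matrix_vector_mult_diff_rdistrib stationarity[of "Suc k"])
  then have "norm (g ?z + A ?z *v ?l) \<le> norm ?s + norm (g ?z - g ?y) + norm ((A ?z - A ?y) *v ?l)"
    by (smt (verit) norm_triangle_ineq)
  moreover have "norm (g ?z - g ?y) \<le> L_f r * norm (p (Suc k))"
    using g_lipschitz[OF U(2,1)] by (simp add: x_Suc[of "Suc k"])
  moreover have "norm ((A ?z - A ?y) *v ?l) \<le> L_c r * norm (p (Suc k)) * \<Lambda>"
  proof -
    have "norm ((A ?z - A ?y) *v ?l) \<le> L_c r * norm (p (Suc k)) * norm ?l"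
      using norm_mult_spectral_le[OF A_lipschitz[OF U(2,1)], of ?l] by (simp add: x_Suc[of "Suc k"])
    also have "\<dots> \<le> L_c r * norm (p (Suc k)) * \<Lambda>"
      using norm_l_Suc_le[OF adm_Suc] by (intro mult_left_mono) auto
    finally show ?thesis .
  qed
  ultimately have "norm (g ?z + A ?z *v ?l) \<le> C_s r q * norm (p (Suc k))"
    using norm_stationarity_le[OF adm_Suc] by (simp add: C_s_def A_p_def algebra_simps)
  then have "(norm (g ?z + A ?z *v ?l))\<^sup>2 \<le> (C_s r q * norm (p (Suc k)))\<^sup>2"
    by (intro power_mono) auto
  also have "\<dots> \<le> (C_s r q)\<^sup>2 * ?P"
    by (simp add: power_mult_distrib mult_left_mono)
  finally have grad: "(norm (g ?z + A ?z *v ?l))\<^sup>2 \<le> (C_s r q)\<^sup>2 * ?P" .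
  have "(\<rho> * norm (c ?z))\<^sup>2 = (norm (l (Suc (Suc k)) - l (Suc k)))\<^sup>2"
    by (simp add: l_Suc[of "Suc k"] power_mult_distrib)
  also have "\<dots> \<le> C_lam_p r q / 2 * ?P" by (rule multiplier_increment_le)
  also have "\<dots> \<le> C_lam_p r q * ?P" using C_lam_p_nonneg by (intro mult_right_mono) auto
  finally have "(norm (c ?z))\<^sup>2 \<le> C_lam_p r q / \<rho>\<^sup>2 * ?P"
    by (simp add: pos_le_divide_eq power_mult_distrib mult.commute)
  with grad show ?thesis
    by (simp add: KKT_residual_def C_R_def distrib_right)
qed

end

section \<open>Invariance of admissibility and telescoping\<close>

lemma admissible_Suc:
  assumes "admissible k" "\<Phi> (Suc k) \<le> Phi1_bar f r q x0"
  shows "admissible (Suc k)"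
  using norm_l_Suc_le[OF assms(1)] norm_c_Suc_le[OF assms(1)] f_le_Phi[of "Suc k"] assms(2)
  by (auto simp: admissible_def S_det_def H_det_def pos_le_divide_eq mult.commute)

text \<open>The claims are interleaved: \<open>Phi_descent\<close> needs two consecutive admissible
  iterates, and its bound on the next \<open>\<Phi>\<close> makes the following iterate
  admissible.\<close>

lemma admissible_and_Phi_le: "admissible k \<and> admissible (Suc k) \<and> \<Phi> (Suc k) \<le> Phi1_bar f r q x0"
proof (induction k)
  case 0
  then show ?case using admissible_0 Phi_1_le admissible_Suc[of 0] by simp
next
  case (Suc k)
  moreover have "0 \<le> \<beta> / 4 * (norm (p (Suc k)))\<^sup>2" by simp
  ultimately have "\<Phi> (Suc (Suc k)) \<le> Phi1_bar f r q x0" using Phi_descent[of k] by linarith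
  then show ?case using Suc admissible_Suc[of "Suc k"] by auto
qed

lemma all_admissible: "admissible k"
  using admissible_and_Phi_le by blast

lemma Phi_low_le: "Phi_low r q \<le> \<Phi> k"
  using f_le_Phi[OF norm_l_le] f_lower[OF xU] all_admissible[of k]
  by (fastforce simp: Phi_low_def)

lemma sum_step_sq_le:
  "(\<Sum>k=1..n. (norm (p k))\<^sup>2) \<le> 4 / \<beta> * (\<Phi> 1 - \<Phi> (Suc n))"
proof (induction n)
  case (Suc n)
  have "\<beta> / 4 * (norm (p (Suc n)))\<^sup>2 \<le> \<Phi> (Suc n) - \<Phi> (Suc (Suc n))"
    using Phi_descent[OF all_admissible all_admissible, of n] by linarith
  then have "(norm (p (Suc n)))\<^sup>2 \<le> 4 / \<beta> * (\<Phi> (Suc n) - \<Phi> (Suc (Suc n)))"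
    by (simp add: field_simps)
  then show ?case using Suc by (simp add: algebra_simps)
qed simp

lemma sum_residual_sq_le: "(\<Sum>k=1..n. (R (k + 1))\<^sup>2) \<le> C_det f c r q x l p"
proof -
  let ?P = "\<lambda>k. (norm (p k))\<^sup>2"
  have C_R: "0 \<le> C_R r q" using C_lam_p_nonneg by (simp add: C_R_def)
  have "(\<Sum>k=1..n. (R (k + 1))\<^sup>2) \<le> (\<Sum>k=1..n. C_R r q * (?P k + ?P (k - 1)))"
  proof (rule sum_mono)
    fix k assume "k \<in> {1..n}"
    then obtain j where "k = Suc j" by (cases k) auto
    then show "(R (k + 1))\<^sup>2 \<le> C_R r q * (?P k + ?P (k - 1))"
      using residual_le[OF all_admissible all_admissible, of j] by simp
  qed
  also have "\<dots> = C_R r q * ((\<Sum>k=1..n. ?P k) + (\<Sum>k=1..n. ?P (k - 1)))"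
    by (simp add: sum.distrib flip: sum_distrib_left)
  also have "\<dots> \<le> C_R r q * (\<Delta>\<^sup>2 + 8 * (\<Phi> 1 - Phi_low r q) / \<beta>)"
  proof (rule mult_left_mono[OF _ C_R])
    \<comment> \<open>Each residual involves two steps, so the step sum counts twice, turning 4 into
      8. The shifted sum also contains \<open>p 0\<close>, which descent does not control; it
      contributes \<open>\<Delta>\<^sup>2\<close>.\<close>
    have "(\<Sum>k=1..n. ?P (k - 1)) + ?P n = ?P 0 + (\<Sum>k=1..n. ?P k)"
      by (induction n) auto
    moreover have "0 \<le> ?P n" by simp
    moreover have "?P 0 \<le> \<Delta>\<^sup>2"
      using norm_p_le[OF all_admissible] by (intro power_mono) auto
    moreover have "4 / \<beta> * (\<Phi> 1 - \<Phi> (Suc n)) \<le> 4 / \<beta> * (\<Phi> 1 - Phi_low r q)"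
      using Phi_low_le[of "Suc n"] by (intro mult_left_mono) auto
    moreover have "8 * (\<Phi> 1 - Phi_low r q) / \<beta> = 2 * (4 / \<beta> * (\<Phi> 1 - Phi_low r q))" by simp
    ultimately show "(\<Sum>k=1..n. ?P k) + (\<Sum>k=1..n. ?P (k - 1)) \<le> \<Delta>\<^sup>2 + 8 * (\<Phi> 1 - Phi_low r q) / \<beta>"
      using sum_step_sq_le[of n] by linarith
  qed
  finally show ?thesis by (simp add: C_det_def)
qed

lemma C_det_nonneg: "0 \<le> C_det f c r q x l p"
  using sum_residual_sq_le[of 0] by simp

section \<open>Expected residual and approximate KKT pairs\<close>

lemma Min_residual_le_expectation:
  assumes "2 \<le> K"
  shows "Min ((\<lambda>k. (R (k + 1))\<^sup>2) ` {1..K - 1})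
      \<le> measure_pmf.expectation (pmf_of_set {1..K - 1}) (\<lambda>k. (R (k + 1))\<^sup>2)"
    and "measure_pmf.expectation (pmf_of_set {1..K - 1}) (\<lambda>k. (R (k + 1))\<^sup>2)
      \<le> C_det f c r q x l p / (real K - 1)"
proof -
  let ?a = "\<lambda>k. (R (k + 1))\<^sup>2"
  have "{1..K - 1} \<noteq> {}" using assms by simp
  then have E: "measure_pmf.expectation (pmf_of_set {1..K - 1}) ?a = sum ?a {1..K - 1} / (real K - 1)"
    using assms by (subst integral_pmf_of_set) (auto simp: of_nat_diff)
  have "(real K - 1) * Min (?a ` {1..K - 1}) \<le> sum ?a {1..K - 1}"
    using sum_bounded_below[of "{1..K - 1}" "Min (?a ` {1..K - 1})" ?a] assms by (simp add: of_nat_diff)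
  then show "Min (?a ` {1..K - 1}) \<le> measure_pmf.expectation (pmf_of_set {1..K - 1}) ?a"
    unfolding E using assms by (subst pos_le_divide_eq) (auto simp: mult.commute)
  show "measure_pmf.expectation (pmf_of_set {1..K - 1}) ?a \<le> C_det f c r q x l p / (real K - 1)"
    unfolding E using assms by (intro divide_right_mono sum_residual_sq_le) auto
qed

lemma argmin_residual_eps_KKT:
  assumes \<epsilon>: "0 < \<epsilon>" and K: "2 \<le> K" and large: "C_det f c r q x l p / \<epsilon>\<^sup>2 \<le> real K - 1"
    and min: "is_arg_min (\<lambda>k. R (k + 1)) (\<lambda>k. k \<in> {1..K - 1}) ks"
  shows "eps_KKT f c \<epsilon> (x (ks + 1)) (l (ks + 1))"
proof -
  have ks: "ks \<in> {1..K - 1}" "\<And>k. k \<in> {1..K - 1} \<Longrightarrow> R (ks + 1) \<le> R (k + 1)"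
    using min by (auto simp: is_arg_min_linorder)
  have "(R (ks + 1))\<^sup>2 \<le> Min ((\<lambda>k. (R (k + 1))\<^sup>2) ` {1..K - 1})"
    using ks K by (subst Min_ge_iff) (auto intro!: power_mono simp: KKT_residual_def)
  also have "\<dots> \<le> C_det f c r q x l p / (real K - 1)"
    using Min_residual_le_expectation[OF K] by linarith
  also have "\<dots> \<le> \<epsilon>\<^sup>2"
    using large \<epsilon> K by (simp add: field_simps)
  finally have "(norm (g (x (ks + 1)) + A (x (ks + 1)) *v l (ks + 1)))\<^sup>2 + (norm (c (x (ks + 1))))\<^sup>2 \<le> \<epsilon>\<^sup>2"
    by (simp add: KKT_residual_def)
  then have "(norm (g (x (ks + 1)) + A (x (ks + 1)) *v l (ks + 1)))\<^sup>2 \<le> \<epsilon>\<^sup>2" "(norm (c (x (ks + 1))))\<^sup>2 \<le> \<epsilon>\<^sup>2"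
    by (smt (verit) zero_le_power2)+
  then show ?thesis
    using \<epsilon> unfolding eps_KKT_def by (meson less_imp_le power2_le_imp_le)
qed

end

section \<open>Complexity\<close>

lemma iteration_budget_props:
  "2 \<le> iteration_budget C \<epsilon>" "C / \<epsilon>\<^sup>2 \<le> real (iteration_budget C \<epsilon>) - 1"
proof -
  have "\<exists>K. 2 \<le> K \<and> C / \<epsilon>\<^sup>2 \<le> real K - 1"
    by (rule exI[of _ "2 + nat \<lceil>C / \<epsilon>\<^sup>2\<rceil>"]) (auto, linarith)
  then have "2 \<le> iteration_budget C \<epsilon> \<and> C / \<epsilon>\<^sup>2 \<le> real (iteration_budget C \<epsilon>) - 1"
    unfolding iteration_budget_def by (rule LeastI_ex)
  then show "2 \<le> iteration_budget C \<epsilon>" "C / \<epsilon>\<^sup>2 \<le> real (iteration_budget C \<epsilon>) - 1" by auto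
qed

text \<open>The witness starts at 2, and rounding up adds less than 1.\<close>

lemma iteration_budget_le:
  assumes "0 \<le> C"
  shows "real (iteration_budget C \<epsilon>) \<le> C / \<epsilon>\<^sup>2 + 3"
proof -
  have "iteration_budget C \<epsilon> \<le> 2 + nat \<lceil>C / \<epsilon>\<^sup>2\<rceil>"
    unfolding iteration_budget_def by (rule Least_le) (auto, linarith)
  moreover have "0 \<le> C / \<epsilon>\<^sup>2" using assms by simp
  ultimately show ?thesis by linarith
qed

text \<open>The affine form covers all three complexity counts. For \<open>\<epsilon> < 1\<close>
  the additive constants are absorbed because \<open>1 / \<epsilon>\<^sup>2\<close> is at least
  1.\<close>

lemma iteration_budget_affine_bigo:
  assumes "0 \<le> C"
  shows "(\<lambda>\<epsilon>. real (a * iteration_budget C \<epsilon> + b)) \<in> O[at_right 0](\<lambda>\<epsilon>. 1 / \<epsilon>\<^sup>2)"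
proof (rule bigoI[where c = "real a * (C + 3) + real b"])
  have "norm (real (a * iteration_budget C \<epsilon> + b)) \<le> (real a * (C + 3) + real b) * norm (1 / \<epsilon>\<^sup>2)"
    if "0 < \<epsilon>" "\<epsilon> < 1" for \<epsilon> :: real
  proof -
    have one: "1 \<le> 1 / \<epsilon>\<^sup>2" using that by (simp add: power_le_one)
    have "(C + 3) * (1 / \<epsilon>\<^sup>2) = C / \<epsilon>\<^sup>2 + 3 * (1 / \<epsilon>\<^sup>2)" by (simp add: add_divide_distrib)
    then have "real (iteration_budget C \<epsilon>) \<le> (C + 3) * (1 / \<epsilon>\<^sup>2)"
      using iteration_budget_le[OF assms, of \<epsilon>] one by linarith
    then have "real a * real (iteration_budget C \<epsilon>) \<le> real a * ((C + 3) * (1 / \<epsilon>\<^sup>2))"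
      by (intro mult_left_mono) auto
    moreover have "real b * 1 \<le> real b * (1 / \<epsilon>\<^sup>2)" using one by (intro mult_left_mono) auto
    ultimately show ?thesis by (simp add: algebra_simps add_divide_distrib)
  qed
  then show "\<forall>\<^sub>F \<epsilon> in at_right 0. norm (real (a * iteration_budget C \<epsilon> + b))
      \<le> (real a * (C + 3) + real b) * norm (1 / \<epsilon>\<^sup>2)"
    unfolding eventually_at_right_field by (intro exI[of _ 1]) auto
qed

text \<open>The extra one is \<open>Eval_c (x 0)\<close>, made before the first iteration.\<close>

lemma num_oracle_evals_calls: "num_oracle_evals (calls f c q x l k) = 3 * k + 1"
  by (induction k) (auto simp: num_oracle_evals_def)

lemma num_lin_solves_calls: "num_lin_solves (calls f c q x l k) = k"
  by (induction k) (auto simp: num_lin_solves_def)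

theorem theorem2p12:
  fixes f :: "real^'n \<Rightarrow> real" and c :: "real^'n \<Rightarrow> real^'m"
    and U :: "(real^'n) set" and r :: reg_consts and q :: alg_params
    and x0 :: "real^'n" and l0 :: "real^'m"
    and x :: "nat \<Rightarrow> real^'n" and l :: "nat \<Rightarrow> real^'m" and p :: "nat \<Rightarrow> real^'n"
  assumes regularity: "regularity f c U r"
    and parameters: "parameter_cond c r q x0 l0"
    and localization: "closed_nbhd (Del q) (S_det f c r q x0) \<subseteq> U"
    and run: "NR_LALM f c q x0 l0 x l p"
  shows
    "let R = (\<lambda>k. KKT_residual f c (x k) (l k));
         C = C_det f c r q x l p;
         N = iteration_budget C
     in
       (\<forall>K\<ge>2.
          Min ((\<lambda>k. (R (k + 1))\<^sup>2) ` {1..K - 1})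
            \<le> measure_pmf.expectation (pmf_of_set {1..K - 1}) (\<lambda>k. (R (k + 1))\<^sup>2) \<and>
          measure_pmf.expectation (pmf_of_set {1..K - 1}) (\<lambda>k. (R (k + 1))\<^sup>2)
            \<le> C / (real K - 1)) \<and>
       (\<forall>\<epsilon>>0. \<forall>K\<ge>2. \<forall>ks.
          real K - 1 \<ge> C / \<epsilon>\<^sup>2 \<longrightarrow>
          is_arg_min (\<lambda>k. R (k + 1)) (\<lambda>k. k \<in> {1..K - 1}) ks \<longrightarrow>
          eps_KKT f c \<epsilon> (x (ks + 1)) (l (ks + 1))) \<and>
       (\<forall>\<epsilon>>0. \<exists>ks.
          is_arg_min (\<lambda>k. R (k + 1)) (\<lambda>k. k \<in> {1..N \<epsilon> - 1}) ks \<and>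
          eps_KKT f c \<epsilon> (x (ks + 1)) (l (ks + 1))) \<and>
       (\<lambda>\<epsilon>. real (N \<epsilon>)) \<in> O[at_right 0](\<lambda>\<epsilon>. 1 / \<epsilon>\<^sup>2) \<and>
       (\<lambda>\<epsilon>. real (num_oracle_evals (calls f c q x l (N \<epsilon>)))) \<in> O[at_right 0](\<lambda>\<epsilon>. 1 / \<epsilon>\<^sup>2) \<and>
       (\<lambda>\<epsilon>. real (num_lin_solves (calls f c q x l (N \<epsilon>)))) \<in> O[at_right 0](\<lambda>\<epsilon>. 1 / \<epsilon>\<^sup>2)"
proof -
  interpret nr_lalm f c U r q x0 l0 x l p
    using assms by unfold_locales
  let ?C = "C_det f c r q x l p"
  have argmin: "\<exists>ks. is_arg_min (\<lambda>k. R (k + 1)) (\<lambda>k. k \<in> {1..K - 1}) ks" if "2 \<le> K" for K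
  proof -
    have "{1..K - 1} \<noteq> {}" using that by simp
    then show ?thesis by (intro ex_is_arg_min_if_finite) auto
  qed
  have budget: "\<exists>ks. is_arg_min (\<lambda>k. R (k + 1)) (\<lambda>k. k \<in> {1..iteration_budget ?C \<epsilon> - 1}) ks \<and>
      eps_KKT f c \<epsilon> (x (ks + 1)) (l (ks + 1))" if "0 < \<epsilon>" for \<epsilon>
    using argmin[OF iteration_budget_props(1)]
      argmin_residual_eps_KKT[OF that iteration_budget_props] by blast
  show ?thesis
    unfolding Let_def num_oracle_evals_calls num_lin_solves_calls
  proof (intro conjI allI impI)
    show "(\<lambda>\<epsilon>. real (iteration_budget ?C \<epsilon>)) \<in> O[at_right 0](\<lambda>\<epsilon>. 1 / \<epsilon>\<^sup>2)"
      using iteration_budget_affine_bigo[OF C_det_nonneg, of 1 0] by simp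
    \<comment> \<open>After the rewriting, the claim on linear solves coincides with that on
      iterations.\<close>
    then show "(\<lambda>\<epsilon>. real (iteration_budget ?C \<epsilon>)) \<in> O[at_right 0](\<lambda>\<epsilon>. 1 / \<epsilon>\<^sup>2)" .
    show "(\<lambda>\<epsilon>. real (3 * iteration_budget ?C \<epsilon> + 1)) \<in> O[at_right 0](\<lambda>\<epsilon>. 1 / \<epsilon>\<^sup>2)"
      by (rule iteration_budget_affine_bigo[OF C_det_nonneg])
  qed (fact Min_residual_le_expectation argmin_residual_eps_KKT budget)+
qed

end
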